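(* Let $S=\langle n_1,n_2,n_3,n_4\rangle$ be a 4-generated pseudo-symmetric numerical semigroup with parameters $\alpha_1,\alpha_2,\alpha_3,\alpha_4,\alpha_{21}$, where $\alpha_4=3$, $n_1<n_2<n_3<n_4$ and $\alpha_2>\alpha_{21}+1$. Let $l\ge 0$ be the smallest non-negative integer satisfying $$l\alpha_1+(2l+3)\alpha_{21}+\alpha_3>(2l+2)\alpha_2+(l+1).$$ If $l=0$, then the local ring $R_S=K[[t^{n_1},t^{n_2},t^{n_3},t^{n_4}]]$ has a non-decreasing Hilbert function, i.e. $H_{R_S}(n)\le H_{R_S}(n+1)$ for all $n\ge 0$.
   Context: Parameters: a 4-generated numerical semigroup $S=\langle n_1,n_2,n_3,n_4\rangle$ ($\gcd(n_1,\dots,n_4)=1$) is pseudo-symmetric if and only if there are integers $\alpha_i>1$ ($1\le i\le 4$) and $\alpha_{21}$ with $0<\alpha_{21}<\alpha_1-1$ such that $n_1=\alpha_2\alpha_3(\alpha_4-1)+1$, $n_2=\alpha_{21}\alpha_3\alpha_4+(\alpha_1-\alpha_{21}-1)(\alpha_3-1)+\alpha_3$, $n_3=\alpha_1\alpha_4+(\alpha_1-\alpha_{21}-1)(\alpha_2-1)(\alpha_4-1)-\alpha_4+1$, $n_4=\alpha_1\alpha_2(\alpha_3-1)+\alpha_{21}(\alpha_2-1)+\alpha_2$. These integers are the parameters of $S$. $K$ is an algebraically closed field, $\mathfrak m=\langle t^{n_1},\dots,t^{n_4}\rangle$ is the maximal ideal of $R_S$, and the Hilbert function of $R_S$ is $H_{R_S}(n)=\dim_{R_S/\mathfrak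 m}(\mathfrak m^n/\mathfrak m^{n+1})$ for $n\ge 0$. *)

theory Defs
  imports
    "HOL-Algebra.Ideal_Product"
    "HOL-Algebra.QuotRing"
    "HOL-Computational_Algebra.Polynomial"
    "HOL-Computational_Algebra.Formal_Power_Series"
    "Jordan_Normal_Form.Missing_VectorSpace"
begin

section \<open>Numerical semigroups\<close>

definition weight :: "nat list \<Rightarrow> nat list \<Rightarrow> nat" where
  "weight ns es = (\<Sum>i<length ns. es ! i * ns ! i)"

definition generated_semigroup :: "nat list \<Rightarrow> nat set" where
  "generated_semigroup ns = {weight ns es | es. length es = length ns}"

text \<open>The semigroup generated by \<open>ns\<close> has finite complement, and \<open>ns\<close> lists its minimal generators
  without repetition.\<close>

definition minimally_generates :: "nat list \<Rightarrow> bool" where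
  "minimally_generates ns \<longleftrightarrow> Gcd (set ns) = 1 \<and>
     (\<forall>i<length ns. ns ! i \<notin> generated_semigroup (take i ns @ drop (Suc i) ns))"

text \<open>Gaps are taken in the integers, so every negative integer is one; the Frobenius number of the
  semigroup of all natural numbers is \<open>-1\<close>.\<close>

definition frobenius_number :: "nat set \<Rightarrow> int" where
  "frobenius_number S = (GREATEST x. x \<notin> int ` S)"

definition pseudo_frobenius :: "nat set \<Rightarrow> int set" where
  "pseudo_frobenius S = {x. x \<notin> int ` S \<and> (\<forall>s\<in>S - {0}. x + int s \<in> int ` S)}"

definition pseudo_symmetric :: "nat set \<Rightarrow> bool" where
  "pseudo_symmetric S \<longleftrightarrow> even (frobenius_number S) \<and>
     pseudo_frobenius S = {frobenius_number S div 2, frobenius_number S}"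

definition has_parameters ::
  "nat \<Rightarrow> nat \<Rightarrow> nat \<Rightarrow> nat \<Rightarrow> int \<Rightarrow> int \<Rightarrow> int \<Rightarrow> int \<Rightarrow> int \<Rightarrow> bool" where
  "has_parameters n\<^sub>1 n\<^sub>2 n\<^sub>3 n\<^sub>4 \<alpha>\<^sub>1 \<alpha>\<^sub>2 \<alpha>\<^sub>3 \<alpha>\<^sub>4 \<alpha>\<^sub>2\<^sub>1 \<longleftrightarrow>
     \<alpha>\<^sub>1 > 1 \<and> \<alpha>\<^sub>2 > 1 \<and> \<alpha>\<^sub>3 > 1 \<and> \<alpha>\<^sub>4 > 1 \<and> 0 < \<alpha>\<^sub>2\<^sub>1 \<and> \<alpha>\<^sub>2\<^sub>1 < \<alpha>\<^sub>1 - 1 \<and>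
     int n\<^sub>1 = \<alpha>\<^sub>2 * \<alpha>\<^sub>3 * (\<alpha>\<^sub>4 - 1) + 1 \<and>
     int n\<^sub>2 = \<alpha>\<^sub>2\<^sub>1 * \<alpha>\<^sub>3 * \<alpha>\<^sub>4 + (\<alpha>\<^sub>1 - \<alpha>\<^sub>2\<^sub>1 - 1) * (\<alpha>\<^sub>3 - 1) + \<alpha>\<^sub>3 \<and>
     int n\<^sub>3 = \<alpha>\<^sub>1 * \<alpha>\<^sub>4 + (\<alpha>\<^sub>1 - \<alpha>\<^sub>2\<^sub>1 - 1) * (\<alpha>\<^sub>2 - 1) * (\<alpha>\<^sub>4 - 1) - \<alpha>\<^sub>4 + 1 \<and>
     int n\<^sub>4 = \<alpha>\<^sub>1 * \<alpha>\<^sub>2 * (\<alpha>\<^sub>3 - 1) + \<alpha>\<^sub>2\<^sub>1 * (\<alpha>\<^sub>2 - 1) + \<alpha>\<^sub>2"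


section \<open>The local ring of a numerical semigroup\<close>

text \<open>Substitutes \<open>t ^ (ns ! i)\<close> for \<open>x\<^sub>i\<close> in the formal power series in \<open>length ns\<close> variables whose
  coefficient at the exponent vector \<open>es\<close> is \<open>c es\<close>. The sum over each degree \<open>d\<close> is finite if the
  entries of \<open>ns\<close> are positive (\<open>finite_weight_eq\<close> below).\<close>

definition monomial_subst :: "nat list \<Rightarrow> (nat list \<Rightarrow> 'k::field) \<Rightarrow> 'k fps" where
  "monomial_subst ns c = Abs_fps (\<lambda>d. \<Sum>es | length es = length ns \<and> weight ns es = d. c es)"

definition semigroup_ring :: "nat list \<Rightarrow> 'k::field fps ring" where
  "semigroup_ring ns =
     \<lparr>carrier = range (monomial_subst ns), monoid.mult = (*), one = 1, ring.zero = 0, add = (+)\<rparr>"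

definition semigroup_ring_max_ideal :: "nat list \<Rightarrow> 'k::field fps set" where
  "semigroup_ring_max_ideal ns =
     genideal (semigroup_ring ns) {fps_X ^ n | n. n \<in> set ns}"


section \<open>The Hilbert function of a local ring\<close>

text \<open>In \<open>ideals_set R\<close> multiplication is the product of ideals and the unit is the unit ideal.\<close>

definition ideal_pow :: "('a, 'b) ring_scheme \<Rightarrow> 'a set \<Rightarrow> nat \<Rightarrow> 'a set" where
  "ideal_pow R M n = M [^]\<^bsub>ideals_set R\<^esub> n"

text \<open>\<open>M ^ n / M ^ (n + 1)\<close> as a module over \<open>R / M\<close>. The product of the cosets of \<open>a\<close> (modulo \<open>M\<close>) and \<open>x\<close>
  (modulo \<open>M ^ (n + 1)\<close>) is the coset of \<open>a x\<close> modulo \<open>M ^ (n + 1)\<close>, see \<open>smult_graded_piece\<close> below. The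
  fields \<open>mult\<close> and \<open>one\<close> of the record have no meaning for a module.\<close>

definition graded_piece :: "('a, 'b) ring_scheme \<Rightarrow> 'a set \<Rightarrow> nat \<Rightarrow> ('a set, 'a set) module" where
  "graded_piece R M n =
     \<lparr>carrier = (\<lambda>x. ideal_pow R M (Suc n) +>\<^bsub>R\<^esub> x) ` ideal_pow R M n,
      monoid.mult = undefined, one = undefined,
      ring.zero = ideal_pow R M (Suc n), add = set_add R,
      module.smult = rcoset_mult R (ideal_pow R M (Suc n))\<rparr>"

definition hilbert_function :: "('a, 'b) ring_scheme \<Rightarrow> 'a set \<Rightarrow> nat \<Rightarrow> nat" where
  "hilbert_function R M n = vectorspace.dim (R Quot M) (graded_piece R M n)"


section \<open>Well-definedness\<close>

lemma finite_weight_eq: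
  assumes "0 \<notin> set ns"
  shows "finite {es. length es = length ns \<and> weight ns es = d}"
proof (rule finite_subset)
  show "{es. length es = length ns \<and> weight ns es = d} \<subseteq> {es. set es \<subseteq> {..d} \<and> length es = length ns}"
  proof safe
    fix es e assume len: "length es = length ns" and d: "d = weight ns es" and "e \<in> set es"
    then obtain i where i: "i < length ns" "e = es ! i" by (metis in_set_conv_nth)
    have "ns ! i > 0" using assms i by (metis gr0I nth_mem)
    then have "e \<le> es ! i * ns ! i" using i by simp
    also have "\<dots> \<le> weight ns es"
      unfolding weight_def using i by (intro member_le_sum) auto
    finally show "e \<le> weight ns es" .
  qed
  show "finite {es. set es \<subseteq> {..d} \<and> length es = length ns}"
    by (rule finite_lists_length_eq) simp
qed

text \<open>The ring consists of the power series with support in the semigroup.\<close>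

lemma carrier_semigroup_ring:
  assumes "0 \<notin> set ns"
  shows "carrier (semigroup_ring ns :: 'k::field fps ring)
           = {f. \<forall>d. fps_nth f d \<noteq> 0 \<longrightarrow> d \<in> generated_semigroup ns}"
proof (intro equalityI subsetI)
  fix f :: "'k fps" assume "f \<in> carrier (semigroup_ring ns)"
  then obtain c where f: "f = monomial_subst ns c" by (auto simp: semigroup_ring_def)
  have "d \<in> generated_semigroup ns" if "fps_nth f d \<noteq> 0" for d
  proof (rule ccontr)
    assume "d \<notin> generated_semigroup ns"
    then have "{es. length es = length ns \<and> weight ns es = d} = {}"
      by (auto simp: generated_semigroup_def)
    then have "fps_nth f d = 0"
      unfolding f monomial_subst_def fps_nth_Abs_fps by (simp only: sum.empty)
    then show False using that by contradiction
  qed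
  then show "f \<in> {f. \<forall>d. fps_nth f d \<noteq> 0 \<longrightarrow> d \<in> generated_semigroup ns}" by simp
next
  fix f :: "'k fps" assume "f \<in> {f. \<forall>d. fps_nth f d \<noteq> 0 \<longrightarrow> d \<in> generated_semigroup ns}"
  then have f: "d \<in> generated_semigroup ns" if "fps_nth f d \<noteq> 0" for d using that by simp
  define g where "g d = (SOME es. length es = length ns \<and> weight ns es = d)" for d
  define c where "c es = (if es = g (weight ns es) then fps_nth f (weight ns es) else 0)" for es
  have "fps_nth (monomial_subst ns c) d = fps_nth f d" for d
  proof (cases "d \<in> generated_semigroup ns")
    case True
    let ?A = "{es. length es = length ns \<and> weight ns es = d}"
    have "\<exists>es. length es = length ns \<and> weight ns es = d"
      using True by (auto simp: generated_semigroup_def)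
    then have "length (g d) = length ns \<and> weight ns (g d) = d"
      unfolding g_def by (rule someI_ex)
    then have "g d \<in> ?A" by simp
    moreover have "(\<Sum>es\<in>?A. c es) = (\<Sum>es\<in>?A. if es = g d then fps_nth f d else 0)"
      by (intro sum.cong) (auto simp: c_def)
    ultimately show ?thesis
      using finite_weight_eq[OF assms, of d] by (simp add: monomial_subst_def)
  next
    case False
    then have "{es. length es = length ns \<and> weight ns es = d} = {}"
      by (auto simp: generated_semigroup_def)
    then have "fps_nth (monomial_subst ns c) d = 0"
      unfolding monomial_subst_def fps_nth_Abs_fps by (simp only: sum.empty)
    then show ?thesis using f[of d] False by auto
  qed
  then have "f = monomial_subst ns c" by (simp add: fps_eq_iff)
  then show "f \<in> carrier (semigroup_ring ns)" by (auto simp: semigroup_ring_def)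
qed

lemma (in cring) ideal_pow_Suc: "ideal_pow R M (Suc n) = ideal_pow R M n \<cdot> M"
  by (simp add: ideal_pow_def ideals_set_def)

lemma (in cring) ideal_ideal_pow:
  assumes "ideal M R"
  shows "ideal (ideal_pow R M n) R"
proof (induction n)
  case 0
  show ?case by (simp add: ideal_pow_def ideals_set_def oneideal)
next
  case (Suc n)
  then show ?case using assms by (simp add: ideal_pow_Suc ideal_prod_is_ideal)
qed

lemma (in cring) smult_graded_piece:
  assumes M: "ideal M R" and a: "a \<in> carrier R" and x: "x \<in> ideal_pow R M n"
  shows "(M +> a) \<odot>\<^bsub>graded_piece R M n\<^esub> (ideal_pow R M (Suc n) +> x)
           = ideal_pow R M (Suc n) +> (a \<otimes> x)"
proof -
  let ?I = "ideal_pow R M n" and ?J = "ideal_pow R M (Suc n)"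
  interpret M: ideal M R by fact
  interpret I: ideal ?I R by (rule ideal_ideal_pow[OF M])
  interpret J: ideal ?J R by (rule ideal_ideal_pow[OF M])
  have xR: "x \<in> carrier R" using x by (rule I.Icarr)
  have eq: "?J +> ((m \<oplus> a) \<otimes> (j \<oplus> x)) = ?J +> (a \<otimes> x)" if m: "m \<in> M" and j: "j \<in> ?J" for m j
  proof -
    have mR: "m \<in> carrier R" and jR: "j \<in> carrier R" using m j by auto
    have "x \<otimes> m \<in> ?J" unfolding ideal_pow_Suc using x m by (rule ideal_prod.prod)
    then have "((m \<oplus> a) \<otimes> j) \<oplus> (x \<otimes> m) \<in> ?J"
      using mR a j by (intro J.a_closed J.I_l_closed[of j]) auto
    moreover have "(m \<oplus> a) \<otimes> (j \<oplus> x) = (((m \<oplus> a) \<otimes> j) \<oplus> (x \<otimes> m)) \<oplus> (a \<otimes> x)"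
      using mR jR a xR by algebra
    ultimately have "(m \<oplus> a) \<otimes> (j \<oplus> x) \<in> ?J +> (a \<otimes> x)"
      by (auto simp: a_r_coset_def')
    then show ?thesis using J.a_repr_independence' a xR by (metis m_closed)
  qed
  have ne: "\<exists>m. m \<in> M" "\<exists>j. j \<in> ?J" using M.zero_closed J.zero_closed by blast+
  have "rcoset_mult R ?J (M +> a) (?J +> x)
          = (\<Union>m\<in>M. \<Union>j\<in>?J. ?J +> ((m \<oplus> a) \<otimes> (j \<oplus> x)))"
    by (simp add: rcoset_mult_def a_r_coset_def')
  also have "\<dots> = (\<Union>m\<in>M. \<Union>j\<in>?J. ?J +> (a \<otimes> x))"
    using eq by simp
  also have "\<dots> = ?J +> (a \<otimes> x)" using ne by auto
  finally show ?thesis by (simp add: graded_piece_def)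
qed

lemma (in cring) vectorspace_graded_piece:
  assumes "maximalideal M R"
  shows "vectorspace (R Quot M) (graded_piece R M n)"
proof -
  interpret M: maximalideal M R by fact
  have M: "ideal M R" by (rule M.is_ideal)
  let ?I = "ideal_pow R M n" and ?J = "ideal_pow R M (Suc n)" and ?V = "graded_piece R M n"
  interpret I: ideal ?I R by (rule ideal_ideal_pow[OF M])
  interpret J: ideal ?J R by (rule ideal_ideal_pow[OF M])
  interpret Q: field "R Quot M" using M.quotient_is_field cring_axioms by blast
  have [simp]: "\<zero>\<^bsub>?V\<^esub> = ?J" and add: "add ?V = set_add R" by (simp_all add: graded_piece_def)
  have V: "X \<in> carrier ?V \<longleftrightarrow> (\<exists>x\<in>?I. X = ?J +> x)" for X by (auto simp: graded_piece_def)
  have Q: "A \<in> carrier (R Quot M) \<longleftrightarrow> (\<exists>a\<in>carrier R. A = M +> a)" for A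
    by (auto simp: FactRing_def A_RCOSETS_def')
  note sm = smult_graded_piece[OF M, of _ _ n]
  have J0: "?J = ?J +> \<zero>" by (simp add: J.a_subset)
  have "abelian_group ?V"
  proof (rule abelian_groupI)
    fix X assume "X \<in> carrier ?V"
    then obtain x where x: "x \<in> ?I" "X = ?J +> x" by (auto simp: V)
    have "(?J +> (\<ominus> x)) <+> (?J +> x) = ?J"
      using x J0 by (simp add: J.a_rcos_sum l_neg)
    moreover have "?J +> (\<ominus> x) \<in> carrier ?V" using x by (auto simp: V)
    ultimately show "\<exists>Y\<in>carrier ?V. Y \<oplus>\<^bsub>?V\<^esub> X = \<zero>\<^bsub>?V\<^esub>" using x by (auto simp: add)
    show "\<zero>\<^bsub>?V\<^esub> \<oplus>\<^bsub>?V\<^esub> X = X" using x J0 J.a_rcos_sum[of \<zero> x] by (auto simp: add)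
  next
    show "\<zero>\<^bsub>?V\<^esub> \<in> carrier ?V" using J0 I.zero_closed by (auto simp: V)
  qed (auto simp: V add J.a_rcos_sum a_ac intro!: bexI)
  then have "module (R Quot M) ?V"
    by (intro moduleI Q.is_cring)
      (auto simp: V Q sm add J.a_rcos_sum M.a_rcos_sum M.rcoset_mult_add FactRing_simps
        I.I_l_closed l_distr r_distr m_assoc intro!: bexI)
  then show ?thesis by (simp add: vectorspace_def Q.field_axioms)
qed

end

theory Submission
  imports Defs "HOL-Number_Theory.Cong"
begin

text \<open>
  The power \<open>\<mm> ^ n\<close> consists of the series supported on elements of order at least \<open>n\<close>, where the order
  of \<open>s \<in> S\<close> is the largest number of generators (with repetition) that sum to \<open>s\<close>. Hence
  \<open>H(n)\<close> is the number of elements of \<open>S\<close> of order \<open>n\<close>.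

  Under the hypotheses there are nine binomials in the defining ideal (five generators and four
  derived from them) whose two terms have different degrees. Exchanging the smaller term
  for the larger one raises the degree, so a factorization of maximal length avoids the nine smaller
  terms; call such a factorization standard. Eliminating \<open>x\<^sub>4\<close> through \<open>n\<^sub>4 = \<alpha>\<^sub>2 n\<^sub>2 - \<alpha>\<^sub>2\<^sub>1 n\<^sub>1\<close>
  assigns to it an integer exponent of \<open>x\<^sub>1\<close> and a standard monomial in \<open>x\<^sub>2, x\<^sub>3\<close>. There are
  \<open>2 \<alpha>\<^sub>2 \<alpha>\<^sub>3 + 1 = n\<^sub>1\<close> of the latter and their weights meet every residue class modulo
  \<open>n\<^sub>1\<close>, so these weights are pairwise incongruent and each element of \<open>S\<close> has exactly one standard
  factorization. Standard monomials of degree \<open>n\<close> then inject into those of degree \<open>n + 1\<close>: multiply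
  by \<open>x\<^sub>1\<close> if possible and otherwise trade \<open>x\<^sub>1 ^ (\<alpha>\<^sub>2\<^sub>1 - 1)\<close> and a factor \<open>x\<^sub>4\<close> for a power of \<open>x\<^sub>2\<close>.
\<close>

section \<open>The Hilbert function in terms of orders\<close>

text \<open>These are the elements of order at least \<open>n\<close>. Asking only for some
  factorization of that length avoids a maximum over all factorizations, and order exactly
  \<open>n\<close> becomes a set difference.\<close>

definition order_at_least :: "nat list \<Rightarrow> nat \<Rightarrow> nat set" where
  "order_at_least ns n = {weight ns es | es. length es = length ns \<and> n \<le> sum_list es}"

lemma in_order_at_least:
  "s \<in> order_at_least ns n \<longleftrightarrow>
     (\<exists>e. s = (\<Sum>i<length ns. e i * ns ! i) \<and> n \<le> (\<Sum>i<length ns. e i))"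
proof
  assume "s \<in> order_at_least ns n"
  then obtain es where "length es = length ns" "s = weight ns es" "n \<le> sum_list es"
    by (auto simp: order_at_least_def)
  then show "\<exists>e. s = (\<Sum>i<length ns. e i * ns ! i) \<and> n \<le> (\<Sum>i<length ns. e i)"
    by (intro exI[of _ "\<lambda>i. es ! i"]) (auto simp: weight_def sum_list_sum_nth atLeast0LessThan)
next
  assume "\<exists>e. s = (\<Sum>i<length ns. e i * ns ! i) \<and> n \<le> (\<Sum>i<length ns. e i)"
  then obtain e where "s = (\<Sum>i<length ns. e i * ns ! i)" "n \<le> (\<Sum>i<length ns. e i)" by blast
  then show "s \<in> order_at_least ns n"
    unfolding order_at_least_def
    by (intro CollectI exI[of _ "map e [0..<length ns]"])
      (auto simp: weight_def sum_list_sum_nth atLeast0LessThan)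
qed

lemma order_at_least_0: "order_at_least ns 0 = generated_semigroup ns"
  by (simp add: order_at_least_def generated_semigroup_def)

lemma order_at_least_antimono: "m \<le> n \<Longrightarrow> order_at_least ns n \<subseteq> order_at_least ns m"
  unfolding order_at_least_def by force

lemma zero_in_order_at_least_0: "0 \<in> order_at_least ns 0"
  unfolding in_order_at_least by (intro exI[of _ "\<lambda>_. 0"]) simp

lemma add_in_order_at_least:
  assumes "s \<in> order_at_least ns m" "t \<in> order_at_least ns n"
  shows "s + t \<in> order_at_least ns (m + n)"
proof -
  obtain e f where "s = (\<Sum>i<length ns. e i * ns ! i)" "m \<le> (\<Sum>i<length ns. e i)"
    "t = (\<Sum>i<length ns. f i * ns ! i)" "n \<le> (\<Sum>i<length ns. f i)"
    using assms unfolding in_order_at_least by blast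
  then show ?thesis unfolding in_order_at_least
    by (intro exI[of _ "\<lambda>i. e i + f i"]) (simp add: sum.distrib algebra_simps)
qed

lemma generator_in_order_at_least_1:
  assumes "k \<in> set ns"
  shows "k \<in> order_at_least ns 1"
proof -
  obtain j where "j < length ns" "k = ns ! j" using assms by (metis in_set_conv_nth)
  then show ?thesis unfolding in_order_at_least
    by (intro exI[of _ "\<lambda>i. if i = j then 1 else 0"]) (simp add: if_distrib[of "\<lambda>x. x * _"] cong: if_cong)
qed

text \<open>A factorization of positive length uses some generator; one copy of it is
  removed.\<close>

lemma order_at_least_SucD:
  assumes "s \<in> order_at_least ns (Suc n)"
  obtains k where "k \<in> set ns" "k \<le> s" "s - k \<in> order_at_least ns n"
proof -
  obtain e where e: "s = (\<Sum>i<length ns. e i * ns ! i)" "Suc n \<le> (\<Sum>i<length ns. e i)"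
    using assms unfolding in_order_at_least by blast
  then have "(\<Sum>i<length ns. e i) \<noteq> 0" by linarith
  then obtain j where j: "j < length ns" "e j \<noteq> 0" by (metis lessThan_iff sum.neutral)
  define e' where "e' i = (if i = j then e j - 1 else e i)" for i
  have split: "(\<Sum>i<length ns. g i) = g j + (\<Sum>i\<in>{..<length ns} - {j}. g i)" for g :: "nat \<Rightarrow> nat"
    using j by (intro sum.remove) auto
  have "(\<Sum>i<length ns. e i) = Suc (\<Sum>i<length ns. e' i)"
    unfolding split[of e] split[of e'] using j by (simp add: e'_def)
  moreover have "e j * ns ! j = ns ! j + (e j - 1) * ns ! j"
    using j by (cases "e j") auto
  then have "s = ns ! j + (\<Sum>i<length ns. e' i * ns ! i)"
    unfolding e split[of "\<lambda>i. e i * ns ! i"] split[of "\<lambda>i. e' i * ns ! i"]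
    by (simp add: e'_def)
  ultimately show thesis using e j
    by (intro that[of "ns ! j"]) (auto simp: in_order_at_least)
qed

lemma zero_notin_order_at_least_Suc:
  assumes "0 \<notin> set ns"
  shows "0 \<notin> order_at_least ns (Suc n)"
  by (metis assms order_at_least_SucD le_zero_eq)

text \<open>Every witness for membership in the first set has length exactly \<open>n\<close>, since
  a longer one would put the element into the second set. Its exponents are therefore at most
  \<open>n\<close>.\<close>

lemma finite_order_diff: "finite (order_at_least ns n - order_at_least ns (Suc n))"
proof (rule finite_subset)
  show "order_at_least ns n - order_at_least ns (Suc n)
      \<subseteq> weight ns ` {es. set es \<subseteq> {..n} \<and> length es = length ns}"
  proof
    fix s assume s: "s \<in> order_at_least ns n - order_at_least ns (Suc n)"
    then obtain es where es: "s = weight ns es" "length es = length ns" "n \<le> sum_list es"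
      by (auto simp: order_at_least_def)
    moreover have "\<not> Suc n \<le> sum_list es" using s es by (auto simp: order_at_least_def)
    ultimately have "e \<le> n" if "e \<in> set es" for e
      using member_le_sum_list[OF that] by simp
    then show "s \<in> weight ns ` {es. set es \<subseteq> {..n} \<and> length es = length ns}" using es by auto
  qed
qed (simp add: finite_lists_length_eq)

lemma order_at_least_0_eq: "order_at_least ns 0 = insert 0 (order_at_least ns (Suc 0))"
proof (intro equalityI subsetI)
  fix s assume "s \<in> order_at_least ns 0"
  then obtain e where e: "s = (\<Sum>i<length ns. e i * ns ! i)" unfolding in_order_at_least by blast
  show "s \<in> insert 0 (order_at_least ns (Suc 0))"
  proof (cases "(\<Sum>i<length ns. e i) = 0")
    case True
    then show ?thesis using e by simp
  next
    case False
    then have "Suc 0 \<le> (\<Sum>i<length ns. e i)" by linarith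
    then show ?thesis using e by (intro insertI2) (auto simp only: in_order_at_least)
  qed
next
  fix s assume "s \<in> insert 0 (order_at_least ns (Suc 0))"
  then show "s \<in> order_at_least ns 0"
    using order_at_least_antimono[of 0 "Suc 0" ns] zero_in_order_at_least_0 by auto
qed

section \<open>Power series supported on elements of given order\<close>

definition supported :: "nat set \<Rightarrow> 'k::field fps set" where
  "supported S = {f. \<forall>d. fps_nth f d \<noteq> 0 \<longrightarrow> d \<in> S}"

lemma supportedD: "f \<in> supported S \<Longrightarrow> d \<notin> S \<Longrightarrow> fps_nth f d = 0"
  by (auto simp: supported_def)

lemma supported_mono: "S \<subseteq> T \<Longrightarrow> supported S \<subseteq> supported T"
  by (auto simp: supported_def)

lemma zero_in_supported: "0 \<in> supported S"
  by (simp add: supported_def)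

lemma add_in_supported: "f \<in> supported S \<Longrightarrow> g \<in> supported S \<Longrightarrow> f + g \<in> supported S"
  unfolding supported_def by (auto, metis add_0)

lemma uminus_in_supported: "f \<in> supported S \<Longrightarrow> - f \<in> supported S"
  by (simp add: supported_def)

lemma sum_in_supported: "(\<And>x. x \<in> A \<Longrightarrow> f x \<in> supported S) \<Longrightarrow> sum f A \<in> supported S"
  by (induction A rule: infinite_finite_induct) (auto intro: zero_in_supported add_in_supported)

lemma const_X_power_nth: "fps_nth (fps_const c * fps_X ^ s) d = (if d = s then c else 0)"
  by simp

lemma const_X_power_in_supported: "s \<in> S \<Longrightarrow> fps_const c * fps_X ^ s \<in> supported S"
  unfolding supported_def const_X_power_nth by auto

lemma mult_in_supported:
  assumes "f \<in> supported (order_at_least ns m)" "g \<in> supported (order_at_least ns n)"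
  shows "f * g \<in> supported (order_at_least ns (m + n))"
  unfolding supported_def
proof (intro CollectI allI impI)
  fix d assume "fps_nth (f * g) d \<noteq> 0"
  then obtain i where "i \<in> {0..d}" "fps_nth f i * fps_nth g (d - i) \<noteq> 0"
    unfolding fps_mult_nth by (rule sum.not_neutral_contains_not_neutral)
  then have "i \<in> order_at_least ns m" "d - i \<in> order_at_least ns n" "i \<le> d"
    using assms by (auto simp: supported_def)
  then show "d \<in> order_at_least ns (m + n)" using add_in_order_at_least by fastforce
qed

text \<open>Although the support may be infinite, \<open>f\<close> is a finite sum of products
  \<open>g k * fps_X ^ k\<close>, one for each generator \<open>k\<close>: every exponent in the
  support allows some generator to be split off, and the terms are grouped by that
  generator.\<close>

lemma supported_Suc_induct [consumes 1, case_names zero add mult]: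
  assumes f: "f \<in> supported (order_at_least ns (Suc n))"
    and zero: "P 0" and add: "\<And>f g. P f \<Longrightarrow> P g \<Longrightarrow> P (f + g)"
    and mult: "\<And>g k. g \<in> supported (order_at_least ns n) \<Longrightarrow> k \<in> set ns \<Longrightarrow> P (g * fps_X ^ k)"
  shows "P f"
proof -
  have "\<forall>d\<in>order_at_least ns (Suc n). \<exists>k. k \<in> set ns \<and> k \<le> d \<and> d - k \<in> order_at_least ns n"
    by (metis order_at_least_SucD)
  then obtain \<kappa> where \<kappa>: "\<And>d. d \<in> order_at_least ns (Suc n) \<Longrightarrow>
      \<kappa> d \<in> set ns \<and> \<kappa> d \<le> d \<and> d - \<kappa> d \<in> order_at_least ns n" by metis
  \<comment> \<open>\<open>g k\<close> gathers the terms of \<open>f\<close> whose chosen generator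
    is \<open>k\<close> and shifts them down by \<open>k\<close>. Each term of \<open>f\<close> is
    thus counted for exactly one \<open>k\<close>.\<close>
  define g where "g k = Abs_fps (\<lambda>d. if \<kappa> (d + k) = k then fps_nth f (d + k) else 0)" for k
  have g: "g k \<in> supported (order_at_least ns n)" for k
    unfolding supported_def
  proof (intro CollectI allI impI)
    fix d assume "fps_nth (g k) d \<noteq> 0"
    then have "\<kappa> (d + k) = k" "fps_nth f (d + k) \<noteq> 0" by (auto simp: g_def split: if_splits)
    then show "d \<in> order_at_least ns n"
      using f \<kappa>[of "d + k"] by (auto simp: supported_def)
  qed
  have "fps_nth f d = fps_nth (\<Sum>k\<in>set ns. g k * fps_X ^ k) d" for d
  proof (cases "d \<in> order_at_least ns (Suc n)")
    case True
    have "fps_nth (g k * fps_X ^ k) d = (if k = \<kappa> d then fps_nth f d else 0)" for k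
      using \<kappa>[OF True] by (auto simp: fps_X_power_mult_right_nth g_def)
    then show ?thesis using \<kappa>[OF True] by (simp add: fps_sum_nth)
  next
    case False
    then have f0: "fps_nth f d = 0" using f by (rule supportedD[rotated])
    then have "fps_nth (g k * fps_X ^ k) d = 0" for k
      by (auto simp: fps_X_power_mult_right_nth g_def)
    then show ?thesis using f0 by (simp add: fps_sum_nth)
  qed
  then have "f = (\<Sum>k\<in>set ns. g k * fps_X ^ k)" by (rule fps_ext)
  moreover have "P (\<Sum>k\<in>A. g k * fps_X ^ k)" if "finite A" "A \<subseteq> set ns" for A
    using that by (induction A rule: finite_induct) (auto intro: zero add mult g)
  ultimately show ?thesis by simp
qed

section \<open>The maximal ideal, its powers and their quotients\<close>

context
  fixes ns :: "nat list" and R :: "'k::field fps ring"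
  assumes pos: "0 \<notin> set ns" and R_eq: "R = semigroup_ring ns"
begin

lemma ring_simps [simp]:
  "carrier R = supported (order_at_least ns 0)"
  "x \<otimes>\<^bsub>R\<^esub> y = x * y" "x \<oplus>\<^bsub>R\<^esub> y = x + y" "\<one>\<^bsub>R\<^esub> = 1" "\<zero>\<^bsub>R\<^esub> = 0"
  unfolding R_eq carrier_semigroup_ring[OF pos] order_at_least_0 supported_def
  by (simp_all add: semigroup_ring_def)

lemma one_in_carrier: "1 \<in> supported (order_at_least ns 0)"
  using const_X_power_in_supported[OF zero_in_order_at_least_0, of 1] by simp

lemma cring_semigroup_ring: "cring R"
proof (rule cringI)
  show "abelian_group R"
    by (rule abelian_groupI)
      (auto intro: add_in_supported zero_in_supported simp: algebra_simps
        intro!: bexI[OF _ uminus_in_supported])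
  show "Group.comm_monoid R"
    using mult_in_supported[of _ ns 0 _ 0] one_in_carrier
    by (intro comm_monoidI) (auto simp: algebra_simps)
qed (simp add: algebra_simps)

interpretation R: cring R by (rule cring_semigroup_ring)

lemma a_minus_eq: "x \<in> carrier R \<Longrightarrow> \<ominus>\<^bsub>R\<^esub> x = - x"
  by (rule R.sum_zero_eq_neg[symmetric]) (auto intro: uminus_in_supported)

lemma ideal_supported: "ideal (supported (order_at_least ns n)) R"
proof (rule idealI)
  have sub: "supported (order_at_least ns n) \<subseteq> supported (order_at_least ns 0)"
    by (intro supported_mono order_at_least_antimono) simp
  show "subgroup (supported (order_at_least ns n)) (add_monoid R)"
  proof (rule R.add.subgroupI)
    show "supported (order_at_least ns n) \<noteq> {}" using zero_in_supported by auto
    fix f :: "'k fps" assume f: "f \<in> supported (order_at_least ns n)"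
    then have "f \<in> carrier R" using sub by auto
    then show "\<ominus>\<^bsub>R\<^esub> f \<in> supported (order_at_least ns n)" 
      using f a_minus_eq uminus_in_supported by metis
  qed (use sub in \<open>auto intro: add_in_supported\<close>)
qed (use mult_in_supported[of _ ns 0 _ n] mult_in_supported[of _ ns n _ 0] in \<open>auto intro: R.ring_axioms\<close>)

lemma X_power_in_supported: "k \<in> set ns \<Longrightarrow> fps_X ^ k \<in> supported (order_at_least ns (Suc 0))"
  using const_X_power_in_supported[OF generator_in_order_at_least_1, of _ _ 1] by simp

text \<open>The generators \<open>fps_X ^ k\<close> have support of positive order, and conversely
  any series of positive order splits into multiples of them by
  \<open>supported_Suc_induct\<close>.\<close>

lemma max_ideal_eq: "semigroup_ring_max_ideal ns = (supported (order_at_least ns (Suc 0)) :: 'k fps set)"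
proof
  let ?X = "{fps_X ^ n | n. n \<in> set ns} :: 'k fps set"
  have X: "?X \<subseteq> supported (order_at_least ns (Suc 0))" using X_power_in_supported by auto
  also have sub: "supported (order_at_least ns (Suc 0)) \<subseteq> carrier R"
    using supported_mono[OF order_at_least_antimono[of 0 "Suc 0"]] by simp
  finally have I: "ideal (genideal R ?X) R" by (rule R.genideal_ideal)
  interpret I: ideal "genideal R ?X" R by (rule I)
  have XI: "?X \<subseteq> genideal R ?X" using X sub by (intro R.genideal_self) auto
  have "genideal R ?X \<subseteq> supported (order_at_least ns (Suc 0))"
    by (rule R.genideal_minimal[OF ideal_supported X])
  then show "semigroup_ring_max_ideal ns \<subseteq> (supported (order_at_least ns (Suc 0)) :: 'k fps set)"
    unfolding semigroup_ring_max_ideal_def R_eq .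
  show "(supported (order_at_least ns (Suc 0)) :: 'k fps set) \<subseteq> semigroup_ring_max_ideal ns"
  proof
    fix f :: "'k fps" assume "f \<in> supported (order_at_least ns (Suc 0))"
    then have "f \<in> supported (order_at_least ns (Suc 0))" by simp
    then have "f \<in> genideal R ?X"
    proof (induction rule: supported_Suc_induct)
      case (zero)
      then show ?case using I.zero_closed by simp
    next
      case (add f g)
      then show ?case using I.a_closed by simp
    next
      case (mult g k)
      then show ?case using I.I_l_closed[of "fps_X ^ k" g] XI by auto
    qed
    then show "f \<in> semigroup_ring_max_ideal ns"
      unfolding semigroup_ring_max_ideal_def R_eq .
  qed
qed

abbreviation "M \<equiv> supported (order_at_least ns (Suc 0)) :: 'k fps set"

text \<open>In the induction step, orders add under multiplication, which gives one inclusion. For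
  the other, each summand \<open>g * fps_X ^ k\<close> from \<open>supported_Suc_induct\<close> is a
  product of an element of the \<open>n\<close>-th power and one of \<open>M\<close>.\<close>

lemma ideal_pow_eq: "ideal_pow R M n = supported (order_at_least ns n)"
proof (induction n)
  case 0
  show ?case by (simp add: ideal_pow_def ideals_set_def)
next
  case (Suc n)
  show ?case unfolding R.ideal_pow_Suc Suc
  proof (intro equalityI subsetI)
    fix f assume "f \<in> supported (order_at_least ns n) \<cdot>\<^bsub>R\<^esub> M"
    then show "f \<in> supported (order_at_least ns (Suc n))"
      by (induction rule: ideal_prod.induct)
        (use mult_in_supported[of _ ns n _ "Suc 0"] in \<open>auto intro: add_in_supported\<close>)
  next
    fix f :: "'k fps" assume "f \<in> supported (order_at_least ns (Suc n))"
    then show "f \<in> supported (order_at_least ns n) \<cdot>\<^bsub>R\<^esub> M"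
    proof (induction rule: supported_Suc_induct)
      case (zero)
      then show ?case using ideal_prod.prod[of 0 "supported (order_at_least ns n)" 0 M R] by (simp add: zero_in_supported)
    next
      case (add f g)
      then show ?case using ideal_prod.sum[of f R] by simp
    next
      case (mult g k)
      then show ?case using ideal_prod.prod[OF mult(1) X_power_in_supported, of k R] by simp
    qed
  qed
qed

lemma const_minus_in_M:
  assumes "f \<in> carrier R"
  shows "f - fps_const (fps_nth f 0) \<in> M"
  using assms by (auto simp: supported_def order_at_least_0_eq)

lemma const_in_carrier: "fps_const c \<in> carrier R"
  using const_X_power_in_supported[OF zero_in_order_at_least_0, of c] by simp

text \<open>A series differs from its constant term by an element of \<open>M\<close>, because
  \<open>0\<close> is the only exponent outside positive order. An ideal that contains
  \<open>M\<close> and a series outside \<open>M\<close> therefore contains a nonzero constant,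
  which is a unit.\<close>

lemma maximalideal_M: "maximalideal M R"
proof (rule maximalidealI[OF ideal_supported])
  have "1 \<notin> M" using zero_notin_order_at_least_Suc[OF pos, of 0] by (auto simp: supported_def)
  then show "carrier R \<noteq> M" using one_in_carrier by auto
next
  fix I assume I: "ideal I R" "M \<subseteq> I" "I \<subseteq> carrier R"
  interpret I: ideal I R by (rule I)
  show "I = M \<or> I = carrier R"
  proof (rule disjCI)
    assume "I \<noteq> carrier R"
    have "f \<in> M" if f: "f \<in> I" for f
    proof -
      let ?c = "fps_nth f 0"
      have fR: "f \<in> carrier R" using f I by blast
      have "?c = 0"
      proof (rule ccontr)
        assume c: "?c \<noteq> 0"
        have "fps_const ?c - f \<in> M" using uminus_in_supported[OF const_minus_in_M[OF fR]] by simp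
        then have "fps_const ?c \<in> I" using I.a_closed[OF f, of "fps_const ?c - f"] I(2) by auto
        then have "fps_const (inverse ?c) * fps_const ?c \<in> I"
          using I.I_l_closed[of "fps_const ?c" "fps_const (inverse ?c)"] const_in_carrier by simp
        then have "1 \<in> I" using c by simp
        then have "I = carrier R" using I.one_imp_carrier by simp
        then show False using \<open>I \<noteq> carrier R\<close> by contradiction
      qed
      then show "f \<in> M" using const_minus_in_M[OF fR] by simp
    qed
    then show "I = M" using I by blast
  qed
qed

text \<open>The cosets of \<open>fps_X ^ s\<close> with \<open>s\<close> of order exactly
  \<open>n\<close> form a basis. They span because a series may be truncated to the exponents in
  \<open>L\<close> modulo \<open>J\<close>. They are independent because scalars are represented by
  constants, so a vanishing combination is a polynomial with exponents in \<open>L\<close> that lies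
  in \<open>J\<close>.\<close>

theorem hilbert_function_eq:
  "hilbert_function R (semigroup_ring_max_ideal ns) n
     = card (order_at_least ns n - order_at_least ns (Suc n))"
proof -
  define J where "J = (supported (order_at_least ns (Suc n)) :: 'k fps set)"
  define L where "L = order_at_least ns n - order_at_least ns (Suc n)"
  let ?V = "graded_piece R M n" and ?Q = "R Quot M"
  interpret M: ideal M R by (rule ideal_supported)
  interpret J: ideal J R unfolding J_def by (rule ideal_supported)
  interpret V: vectorspace ?Q ?V by (rule R.vectorspace_graded_piece[OF maximalideal_M])
  have finL: "finite L" unfolding L_def by (rule finite_order_diff)
  have carrierV: "carrier ?V = (\<lambda>x. J +>\<^bsub>R\<^esub> x) ` supported (order_at_least ns n)"
    and zeroV: "\<zero>\<^bsub>?V\<^esub> = J" and addV: "add ?V = set_add R"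
    by (simp_all add: graded_piece_def ideal_pow_eq J_def)
  have inR: "f \<in> carrier R" if "f \<in> supported (order_at_least ns n)" for f :: "'k fps"
    using that supported_mono[OF order_at_least_antimono[of 0 n]] by auto
  have coset_eq: "J +>\<^bsub>R\<^esub> f = J +>\<^bsub>R\<^esub> g \<longleftrightarrow> f - g \<in> J"
    if "f \<in> carrier R" "g \<in> carrier R" for f g
  proof -
    have "f \<ominus>\<^bsub>R\<^esub> g = f - g" using that by (simp add: a_minus_def a_minus_eq)
    then show ?thesis using R.quotient_eq_iff_same_a_r_cos[OF J.is_ideal that] by auto
  qed
  have coset_zero: "J +>\<^bsub>R\<^esub> 0 = J"
    using J.a_subset R.a_coset_add_zero by simp
  define t where "t s = J +>\<^bsub>R\<^esub> (fps_X ^ s :: 'k fps)" for s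
  define B where "B = t ` L"
  have X: "fps_const c * fps_X ^ s \<in> supported (order_at_least ns n)" if "s \<in> L" for s and c :: 'k
    using that by (intro const_X_power_in_supported) (simp add: L_def)
  have X1: "(fps_X ^ s :: 'k fps) \<in> supported (order_at_least ns n)" if "s \<in> L" for s
    using X[OF that, of 1] by simp
  have tV: "t s \<in> carrier ?V" if "s \<in> L" for s using that X1 by (simp add: t_def carrierV)
  then have BV: "B \<subseteq> carrier ?V" by (auto simp: B_def)
  have sumR: "(\<Sum>s\<in>L. fps_const (c s) * fps_X ^ s) \<in> carrier R" for c
    by (intro inR sum_in_supported X)
  \<comment> \<open>An exponent outside \<open>L\<close> either has order at least
    \<open>Suc n\<close>, where membership in \<open>J\<close> imposes nothing, or does not have
    order at least \<open>n\<close>, and then both coefficients vanish.\<close>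
  have sumJ: "(\<Sum>s\<in>L. fps_const (c s) * fps_X ^ s) - f \<in> J \<longleftrightarrow> (\<forall>s\<in>L. c s = fps_nth f s)"
    if f: "f \<in> supported (order_at_least ns n)" for c and f :: "'k fps"
  proof -
    have nth: "fps_nth (\<Sum>s\<in>L. fps_const (c s) * fps_X ^ s) d = (if d \<in> L then c d else 0)" for d
      using finL unfolding fps_sum_nth const_X_power_nth by simp
    have "d \<in> order_at_least ns n" if "fps_nth f d \<noteq> 0" for d
      using f that by (auto simp: supported_def)
    moreover have "(\<Sum>s\<in>L. fps_const (c s) * fps_X ^ s) - f \<in> J \<longleftrightarrow>
        (\<forall>d. (if d \<in> L then c d else 0) \<noteq> fps_nth f d \<longrightarrow> d \<in> order_at_least ns (Suc n))"
      by (simp add: J_def supported_def nth)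
    ultimately show ?thesis by (auto simp: L_def)
  qed
  have inj: "inj_on t L"
  proof (rule inj_onI)
    fix s s' assume s: "s \<in> L" "s' \<in> L" and "t s = t s'"
    then have "fps_X ^ s - (fps_X ^ s' :: 'k fps) \<in> J"
      using X1 inR unfolding t_def by (subst (asm) coset_eq) blast+
    moreover have "s \<notin> order_at_least ns (Suc n)" using s by (simp add: L_def)
    ultimately have "fps_nth (fps_X ^ s - fps_X ^ s' :: 'k fps) s = 0"
      unfolding J_def by (rule supportedD)
    then show "s = s'" by (simp split: if_splits)
  qed
  have lincomb: "V.lincomb a B = J +>\<^bsub>R\<^esub> (\<Sum>s\<in>L. fps_const (c s) * fps_X ^ s)"
    if a: "\<And>s. s \<in> L \<Longrightarrow> a (t s) = M +>\<^bsub>R\<^esub> fps_const (c s)" for a c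
  proof -
    have term_eq: "a (t s) \<odot>\<^bsub>?V\<^esub> t s = J +>\<^bsub>R\<^esub> (fps_const (c s) * fps_X ^ s)" if "s \<in> L" for s
      using R.smult_graded_piece[OF ideal_supported[of "Suc 0"] const_in_carrier, of "fps_X ^ s" n "c s"] X1 that
      by (simp add: a[OF that] t_def[symmetric] ideal_pow_eq J_def[symmetric])
    have termV: "J +>\<^bsub>R\<^esub> (fps_const (c s) * fps_X ^ s) \<in> carrier ?V" if "s \<in> L" for s
      using X that by (auto simp: carrierV)
    have "V.lincomb a B = (\<Oplus>\<^bsub>?V\<^esub>s\<in>L. a (t s) \<odot>\<^bsub>?V\<^esub> t s)"
      unfolding V.lincomb_def B_def
      by (rule V.finsum_reindex[OF _ inj]) (auto simp: term_eq termV)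
    also have "\<dots> = (\<Oplus>\<^bsub>?V\<^esub>s\<in>L. J +>\<^bsub>R\<^esub> (fps_const (c s) * fps_X ^ s))"
      by (rule V.finsum_cong') (auto simp: term_eq termV)
    also have "\<dots> = J +>\<^bsub>R\<^esub> (\<Sum>s\<in>L. fps_const (c s) * fps_X ^ s)"
      using finL subset_refl[of L]
    proof (induction L rule: finite_subset_induct')
      case empty
      then show ?case by (simp add: zeroV coset_zero)
    next
      case (insert s F)
      have "(\<Sum>s\<in>F. fps_const (c s) * fps_X ^ s) \<in> supported (order_at_least ns n)"
        using insert by (intro sum_in_supported X) auto
      then have "(J +>\<^bsub>R\<^esub> (fps_const (c s) * fps_X ^ s)) <+>\<^bsub>R\<^esub> (J +>\<^bsub>R\<^esub> (\<Sum>s\<in>F. fps_const (c s) * fps_X ^ s))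
        = J +>\<^bsub>R\<^esub> (fps_const (c s) * fps_X ^ s \<oplus>\<^bsub>R\<^esub> (\<Sum>s\<in>F. fps_const (c s) * fps_X ^ s))"
        using X insert inR by (intro J.a_rcos_sum) blast+
      moreover have "(\<lambda>s. J +>\<^bsub>R\<^esub> (fps_const (c s) * fps_X ^ s)) \<in> F \<rightarrow> carrier ?V"
        using insert termV by blast
      ultimately show ?case using insert termV by (simp add: addV)
    qed
    finally show ?thesis .
  qed
  have inQ: "M +>\<^bsub>R\<^esub> fps_const c \<in> carrier ?Q" for c
    using const_in_carrier by (auto simp: FactRing_def A_RCOSETS_def')
  have "V.span B = carrier ?V"
  proof (rule equalityI)
    show "carrier ?V \<subseteq> V.span B"
    proof
      fix v assume "v \<in> carrier ?V"
      then obtain f where f: "v = J +>\<^bsub>R\<^esub> f" "f \<in> supported (order_at_least ns n)"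
        by (auto simp: carrierV)
      \<comment> \<open>Linear combinations take their coefficients indexed by vectors, so the
        exponent is recovered from its coset through the inverse of \<open>t\<close>.\<close>
      define a where "a w = M +>\<^bsub>R\<^esub> fps_const (fps_nth f (the_inv_into L t w))" for w
      have "V.lincomb a B = J +>\<^bsub>R\<^esub> (\<Sum>s\<in>L. fps_const (fps_nth f s) * fps_X ^ s)"
        by (rule lincomb) (simp add: a_def the_inv_into_f_f[OF inj])
      also have "\<dots> = v"
        unfolding f(1) coset_eq[OF sumR inR[OF f(2)]] sumJ[OF f(2)] by simp
      finally have "v = V.lincomb a B" ..
      moreover have "a \<in> B \<rightarrow> carrier ?Q" using inQ by (auto simp: a_def)
      ultimately show "v \<in> V.span B" using finL unfolding V.span_def B_def by blast
    qed
  qed (rule V.span_is_subset2[OF BV])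
  moreover have "\<not> V.lin_dep B"
  proof (rule V.finite_lin_indpt2[OF _ BV])
    show "finite B" using finL by (simp add: B_def)
    fix a assume a: "a \<in> B \<rightarrow> carrier ?Q" and 0: "V.lincomb a B = \<zero>\<^bsub>?V\<^esub>"
    \<comment> \<open>Every scalar is the class of a constant, namely of the constant term of any
      representative.\<close>
    have "\<exists>c. a (t s) = M +>\<^bsub>R\<^esub> fps_const c" if s: "s \<in> L" for s
    proof -
      have "a (t s) \<in> carrier ?Q" using a s by (auto simp: B_def)
      then obtain f where f: "f \<in> carrier R" "a (t s) = M +>\<^bsub>R\<^esub> f"
        by (auto simp: FactRing_def A_RCOSETS_def')
      have "f \<ominus>\<^bsub>R\<^esub> fps_const (fps_nth f 0) = f - fps_const (fps_nth f 0)"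
        using const_in_carrier by (simp add: a_minus_def a_minus_eq)
      then have "M +>\<^bsub>R\<^esub> f = M +>\<^bsub>R\<^esub> fps_const (fps_nth f 0)"
        using R.quotient_eq_iff_same_a_r_cos[OF M.is_ideal f(1) const_in_carrier]
          const_minus_in_M[OF f(1)] by metis
      then show ?thesis using f by auto
    qed
    then obtain c where c: "\<And>s. s \<in> L \<Longrightarrow> a (t s) = M +>\<^bsub>R\<^esub> fps_const (c s)" by metis
    have "J +>\<^bsub>R\<^esub> (\<Sum>s\<in>L. fps_const (c s) * fps_X ^ s) = J +>\<^bsub>R\<^esub> 0"
      using 0 lincomb[of a c, OF c] by (simp add: zeroV coset_zero)
    then have "(\<Sum>s\<in>L. fps_const (c s) * fps_X ^ s) - 0 \<in> J"
      unfolding coset_eq[OF sumR inR[OF zero_in_supported]] .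
    then have "\<forall>s\<in>L. c s = 0" using sumJ[OF zero_in_supported] by simp
    then have "a (t s) = \<zero>\<^bsub>?Q\<^esub>" if "s \<in> L" for s
      using c[OF that] that M.a_subset R.a_coset_add_zero by (simp add: FactRing_def)
    then show "\<forall>v\<in>B. a v = \<zero>\<^bsub>?Q\<^esub>" by (auto simp: B_def)
  qed
  ultimately have "V.basis B" using BV by (simp add: V.basis_def)
  moreover have "finite B" using finL by (simp add: B_def)
  ultimately have "V.dim = card B" by (intro V.dim_basis)
  also have "card B = card L" unfolding B_def by (rule card_image[OF inj])
  finally show ?thesis by (simp add: hilbert_function_def max_ideal_eq L_def)
qed

end


section \<open>Orders in the semigroup\<close>

text \<open>The substitution is \<open>p = \<alpha>\<^sub>2 - 1\<close>,
  \<open>q = \<alpha>\<^sub>3 - 1\<close>, \<open>r = \<alpha>\<^sub>2\<^sub>1\<close>,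
  \<open>u = \<alpha>\<^sub>1 - \<alpha>\<^sub>2\<^sub>1 - 1\<close> with
  \<open>\<alpha>\<^sub>4 = 3\<close>. It makes the formulas polynomials over the naturals without
  subtraction. \<open>level_0\<close> is the defining inequality of \<open>l\<close> at
  \<open>l = 0\<close>.\<close>

locale alpha4_eq_3 =
  fixes n1 n2 n3 n4 p q r u :: nat
  assumes n1: "n1 = 2 * (p + 1) * (q + 1) + 1"
    and n2: "n2 = 3 * r * (q + 1) + u * q + q + 1"
    and n3: "n3 = 3 * r + 3 * u + 2 * u * p + 1"
    and n4: "n4 = (r + u + 1) * (p + 1) * q + r * p + p + 1"
    and pos: "0 < r" "0 < u" "0 < q"
    and less: "n1 < n2" "n2 < n3" "n3 < n4"
    and r_less_p: "r < p"
    and level_0: "2 * p + 2 < 3 * r + q"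
    and coprime: "Gcd {n1, n2, n3, n4} = 1"
begin

section \<open>Binomial relations and the degrees of their terms\<close>

definition wt :: "nat \<Rightarrow> nat \<Rightarrow> nat \<Rightarrow> nat \<Rightarrow> nat" where
  "wt a b c d = a * n1 + b * n2 + c * n3 + d * n4"

lemma binomials:
  shows f1: "(r + u + 1) * n1 = n3 + 2 * n4"
    and f2: "(p + 1) * n2 = r * n1 + n4"
    and f3: "(q + 1) * n3 = u * n1 + n2"
    and f4: "3 * n4 = n1 + p * n2 + q * n3"
    and f5: "n2 + 2 * n4 = (r + 1) * n1 + q * n3"
  by (simp_all add: n1 n2 n3 n4 algebra_simps)

text \<open>By \<open>f2\<close>, \<open>x\<^sub>2 ^ (p + 1)\<close> is replaced by
  \<open>x\<^sub>1 ^ r * x\<^sub>4\<close>, once for \<open>f6\<close> and \<open>f7\<close> and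
  twice for \<open>f8\<close> and \<open>f9\<close>. This produces \<open>x\<^sub>4 ^ 2\<close>, to
  which \<open>f1\<close> applies in \<open>f6\<close> and \<open>f9\<close>, and \<open>f5\<close>
  in \<open>f7\<close> and \<open>f8\<close>.\<close>

lemma derived_binomials:
  shows f6: "(p + 1) * n2 + n3 + n4 = (2 * r + u + 1) * n1"
    and f7: "(p + 2) * n2 + n4 = (2 * r + 1) * n1 + q * n3"
    and f8: "(2 * p + 3) * n2 = (3 * r + 1) * n1 + q * n3"
    and f9: "(2 * p + 2) * n2 + n3 = (3 * r + u + 1) * n1"
  using f1 f2 f5 by (simp_all add: algebra_simps)

text \<open>Since \<open>n1\<close> is the smallest generator, a power of \<open>x\<^sub>1\<close>
  needs more factors than a monomial of the same weight in the other variables.\<close>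

lemma degree_less_if_weight_eq:
  assumes eq: "k * n1 = b * n2 + c * n3 + d * n4" and "0 < d \<or> 0 < c \<or> 0 < b"
  shows "b + c + d < k"
proof (rule ccontr)
  assume "\<not> ?thesis"
  then have "k * n1 \<le> (b + c + d) * n1" by (intro mult_right_mono) auto
  moreover have "b * n1 \<le> b * n2" "c * n1 \<le> c * n3" "d * n1 \<le> d * n4"
    using less by (auto intro!: mult_left_mono)
  moreover have "b * n1 < b * n2 \<or> c * n1 < c * n3 \<or> d * n1 < d * n4"
    using less assms(2) by auto
  ultimately show False using eq unfolding distrib_right by linarith
qed

lemma degree_f1: "3 < r + u + 1"
  using degree_less_if_weight_eq[of "r + u + 1" 0 1 2] f1 by simp

lemma degree_f6: "p + 3 < 2 * r + u + 1"
  using degree_less_if_weight_eq[of "2 * r + u + 1" "p + 1" 1 1] f6 by simp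

lemma degree_f9: "2 * p + 3 < 3 * r + u + 1"
  using degree_less_if_weight_eq[of "3 * r + u + 1" "2 * p + 2" 1 0] f9 by simp

text \<open>As \<open>n2 < n3\<close>, \<open>f3\<close> yields \<open>q * n3 < u * n1\<close>, and
  \<open>n1 < n3\<close> then forces \<open>q < u\<close>.\<close>

lemma degree_f3: "q + 1 < u + 1"
proof (rule ccontr)
  assume "\<not> ?thesis"
  then have "u * n1 \<le> q * n1" by simp
  also have "\<dots> \<le> q * n3" using less by simp
  finally show False using f3 less by (simp add: algebra_simps)
qed

section \<open>Standard monomials and exchange\<close>

definition std :: "nat \<Rightarrow> nat \<Rightarrow> nat \<Rightarrow> nat \<Rightarrow> bool" where
  "std a b c d \<longleftrightarrow>
     d = 0 \<and> c \<le> q \<and> b < 2 * p + 2 \<or>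
     d = 0 \<and> c = 0 \<and> b = 2 * p + 2 \<or>
     d = 1 \<and> a < r \<and> c \<le> q \<and> b \<le> p \<or>
     d = 1 \<and> a < r \<and> c = 0 \<and> b = p + 1 \<or>
     d = 2 \<and> a < r \<and> c = 0 \<and> b = 0"

text \<open>Each case names the binomial whose term of smaller degree divides the monomial.\<close>

lemma not_std_cases:
  assumes "\<not> std a b c d"
  obtains (f1) "1 \<le> c" "2 \<le> d" | (f2) "r \<le> a" "1 \<le> d" | (f3) "q + 1 \<le> c" | (f4) "3 \<le> d"
    | (f5) "1 \<le> b" "2 \<le> d" | (f6) "p + 1 \<le> b" "1 \<le> c" "1 \<le> d" | (f7) "p + 2 \<le> b" "1 \<le> d"
    | (f8) "2 * p + 3 \<le> b" | (f9) "2 * p + 2 \<le> b" "1 \<le> c"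
proof -
  consider "d = 0" | "d = 1" | "d = 2" | "3 \<le> d" by linarith
  then show thesis
  proof cases
    case 1
    with assms have "q + 1 \<le> c \<or> 2 * p + 3 \<le> b \<or> 2 * p + 2 \<le> b \<and> 1 \<le> c"
      unfolding std_def by simp linarith
    with f3 f8 f9 show thesis by blast
  next
    case 2
    with assms have "r \<le> a \<or> q + 1 \<le> c \<or> p + 2 \<le> b \<or> p + 1 \<le> b \<and> 1 \<le> c"
      unfolding std_def by simp linarith
    moreover have "1 \<le> d" using 2 by simp
    ultimately show thesis using f2 f3 f6 f7 by blast
  next
    case 3
    with assms have "r \<le> a \<or> 1 \<le> b \<or> 1 \<le> c"
      unfolding std_def by simp linarith
    moreover have "1 \<le> d" "2 \<le> d" using 3 by simp_all
    ultimately show thesis using f1 f2 f5 by blast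
  next
    case 4
    then show thesis by (rule f4)
  qed
qed

lemma exchange:
  assumes "a0 \<le> a" "b0 \<le> b" "c0 \<le> c" "d0 \<le> d"
    and "wt a0 b0 c0 d0 = wt a1 b1 c1 d1" and "a0 + b0 + c0 + d0 < a1 + b1 + c1 + d1"
  shows "\<exists>a' b' c' d'. wt a' b' c' d' = wt a b c d \<and> a + b + c + d < a' + b' + c' + d'"
proof -
  have "wt (a - a0 + a1) (b - b0 + b1) (c - c0 + c1) (d - d0 + d1) = wt a b c d"
  proof -
    obtain a2 b2 c2 d2 where "a = a0 + a2" "b = b0 + b2" "c = c0 + c2" "d = d0 + d2"
      using assms(1-4) by (meson le_Suc_ex)
    then show ?thesis using assms(5) by (simp add: wt_def algebra_simps)
  qed
  moreover have "a + b + c + d < (a - a0 + a1) + (b - b0 + b1) + (c - c0 + c1) + (d - d0 + d1)"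
    using assms by linarith
  ultimately show ?thesis by blast
qed

text \<open>In each case the smaller term of the named binomial divides the monomial and is
  exchanged for the larger one. The numbers passed to \<open>exchange\<close> are the exponents of
  these two terms, listed alternately.\<close>

lemma not_std_imp_not_maximal:
  assumes "\<not> std a b c d"
  shows "\<exists>a' b' c' d'. wt a' b' c' d' = wt a b c d \<and> a + b + c + d < a' + b' + c' + d'"
  using assms
proof (cases rule: not_std_cases)
  case f1
  then show ?thesis using degree_f1 binomials(1)
    by (intro exchange[of 0 _ 0 _ 1 _ 2 _ "r + u + 1" 0 0 0]) (simp_all add: wt_def)
next
  case f2
  then show ?thesis using r_less_p binomials(2)
    by (intro exchange[of r _ 0 _ 0 _ 1 _ 0 "p + 1" 0 0]) (simp_all add: wt_def)
next
  case f3
  then show ?thesis using degree_f3 binomials(3)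
    by (intro exchange[of 0 _ 0 _ "q + 1" _ 0 _ u 1 0 0]) (simp_all add: wt_def)
next
  case f4
  then show ?thesis using r_less_p pos binomials(4)
    by (intro exchange[of 0 _ 0 _ 0 _ 3 _ 1 p q 0]) (simp_all add: wt_def)
next
  case f5
  then show ?thesis using r_less_p level_0 pos binomials(5)
    by (intro exchange[of 0 _ 1 _ 0 _ 2 _ "r + 1" 0 q 0]) (simp_all add: wt_def)
next
  case f6
  then show ?thesis using degree_f6 derived_binomials(1)
    by (intro exchange[of 0 _ "p + 1" _ 1 _ 1 _ "2 * r + u + 1" 0 0 0]) (simp_all add: wt_def)
next
  case f7
  then show ?thesis using r_less_p level_0 pos derived_binomials(2)
    by (intro exchange[of 0 _ "p + 2" _ 0 _ 1 _ "2 * r + 1" 0 q 0]) (simp_all add: wt_def)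
next
  \<comment> \<open>The required gain \<open>2 * p + 3 < 3 * r + 1 + q\<close> is exactly
    \<open>level_0\<close>; this is where \<open>l = 0\<close> enters in its full strength.\<close>
  case f8
  then show ?thesis using level_0 derived_binomials(3)
    by (intro exchange[of 0 _ "2 * p + 3" _ 0 _ 0 _ "3 * r + 1" 0 q 0]) (simp_all add: wt_def)
next
  case f9
  then show ?thesis using degree_f9 derived_binomials(4)
    by (intro exchange[of 0 _ "2 * p + 2" _ 1 _ 0 _ "3 * r + u + 1" 0 0 0]) (simp_all add: wt_def)
qed

text \<open>The weight bounds the degrees of all factorizations of an element, so repeated exchange
  terminates.\<close>

lemma degree_le_wt: "a + b + c + d \<le> wt a b c d"
proof -
  have "0 < n1" unfolding n1 by linarith
  then have "a \<le> a * n1" "b \<le> b * n2" "c \<le> c * n3" "d \<le> d * n4" using less by auto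
  then show ?thesis unfolding wt_def by linarith
qed

text \<open>The gap between weight and degree shrinks with every exchange, since the weight stays
  fixed while the degree grows.\<close>

lemma ex_std:
  "\<exists>a' b' c' d'. std a' b' c' d' \<and> wt a' b' c' d' = wt a b c d \<and> a + b + c + d \<le> a' + b' + c' + d'"
proof (induction "wt a b c d - (a + b + c + d)" arbitrary: a b c d rule: less_induct)
  case less
  show ?case
  proof (cases "std a b c d")
    case True
    then show ?thesis by blast
  next
    case False
    then obtain a1 b1 c1 d1 where 1: "wt a1 b1 c1 d1 = wt a b c d" "a + b + c + d < a1 + b1 + c1 + d1"
      using not_std_imp_not_maximal by blast
    then have "wt a1 b1 c1 d1 - (a1 + b1 + c1 + d1) < wt a b c d - (a + b + c + d)"
      using degree_le_wt[of a1 b1 c1 d1] by linarith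
    from less.hyps[OF this] 1 show ?thesis by (metis less_le_trans less_imp_le)
  qed
qed

section \<open>Weights modulo \<open>n1\<close> and uniqueness of standard factorizations\<close>

definition residue_reps :: "(nat \<times> nat) set" where
  "residue_reps = {..<2 * p + 2} \<times> {..q} \<union> {(2 * p + 2, 0)}"

lemma card_residue_reps: "card residue_reps = n1"
  by (simp add: residue_reps_def card_insert_if n1 algebra_simps)

lemma finite_residue_reps: "finite residue_reps"
  by (simp add: residue_reps_def)

text \<open>Trading each \<open>x\<^sub>4\<close> for \<open>x\<^sub>2 ^ (p + 1)\<close> sends the
  monomials with \<open>d = 1\<close> to the upper half of the box or to the extra point
  \<open>(2 * p + 2, 0)\<close>, and those with \<open>d = 2\<close> to the extra point.\<close>

lemma std_residue_rep:
  assumes "std a b c d"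
  shows "(b + d * (p + 1), c) \<in> residue_reps"
  using assms by (auto simp: std_def residue_reps_def)

text \<open>\<open>n4\<close> is eliminated by \<open>f2\<close>. The resulting exponent
  \<open>a - d * r\<close> of \<open>x\<^sub>1\<close> may be negative, hence the integers.\<close>

lemma wt_eq_residue_rep: "int (wt a b c d) = (int a - int d * int r) * int n1 + int ((b + d * (p + 1)) * n2 + c * n3)"
proof -
  have "int ((p + 1) * n2) = int (r * n1 + n4)" using f2 by simp
  then have n4: "int n4 = (int p + 1) * int n2 - int r * int n1" by (simp add: algebra_simps)
  show ?thesis unfolding wt_def of_nat_add of_nat_mult n4 by (simp add: algebra_simps)
qed

text \<open>A Bezout combination of the coprime generators equals \<open>1\<close>. Scaling it by
  \<open>k\<close> and reducing its coefficients modulo \<open>n1\<close> makes them natural numbers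
  without changing the residue class.\<close>

lemma ex_wt_mod: "\<exists>a b c d. wt a b c d mod n1 = k mod n1"
proof -
  have "\<exists>x y z w. int (gcd (gcd n1 n2) (gcd n3 n4)) = x * int n1 + y * int n2 + z * int n3 + w * int n4"
  proof -
    obtain x y where xy: "x * int n1 + y * int n2 = gcd (int n1) (int n2)" using bezout_int by blast
    obtain z w where zw: "z * int n3 + w * int n4 = gcd (int n3) (int n4)" using bezout_int by blast
    obtain s t where st: "s * gcd (int n1) (int n2) + t * gcd (int n3) (int n4) = gcd (gcd (int n1) (int n2)) (gcd (int n3) (int n4))"
      using bezout_int by blast
    have "int (gcd (gcd n1 n2) (gcd n3 n4)) = s * (x * int n1 + y * int n2) + t * (z * int n3 + w * int n4)"
      unfolding xy zw st by simp
    also have "\<dots> = (s * x) * int n1 + (s * y) * int n2 + (t * z) * int n3 + (t * w) * int n4"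
      by (simp add: algebra_simps)
    finally show ?thesis by blast
  qed
  moreover have "gcd (gcd n1 n2) (gcd n3 n4) = 1"
    using coprime by (simp add: gcd.assoc)
  ultimately obtain x y z w :: int
    where 1: "x * int n1 + y * int n2 + z * int n3 + w * int n4 = 1" by auto
  define m where "m v = nat ((v * int k) mod int n1)" for v :: int
  have pos1: "int n1 > 0" unfolding n1 by linarith
  have m: "[int (m v) = v * int k] (mod int n1)" for v
    using pos1 by (simp add: m_def cong_def)
  \<comment> \<open>The exponent of \<open>x\<^sub>1\<close> may be taken as \<open>0\<close>,
    because multiples of \<open>n1\<close> vanish modulo \<open>n1\<close>.\<close>
  have "[int (wt 0 (m y) (m z) (m w)) = y * int k * int n2 + z * int k * int n3 + w * int k * int n4] (mod int n1)"
    unfolding wt_def by (simp add: cong_add cong_mult m)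
  also have "y * int k * int n2 + z * int k * int n3 + w * int k * int n4
    = (x * int n1 + y * int n2 + z * int n3 + w * int n4) * int k + (- x * int k) * int n1" by (simp add: algebra_simps)
  also have "[\<dots> = int k] (mod int n1)" unfolding 1 by (simp add: cong_iff_lin)
  finally have "[wt 0 (m y) (m z) (m w) = k] (mod n1)" by (simp add: cong_int_iff)
  then show ?thesis unfolding cong_def by blast
qed

text \<open>Every residue class contains a weight, hence the weight of a standard monomial, hence
  one from \<open>residue_reps\<close>. The map is thus onto a set of the same finite size
  \<open>n1\<close>.\<close>

lemma inj_on_residue_reps: "inj_on (\<lambda>(b, c). (b * n2 + c * n3) mod n1) residue_reps"
proof (rule eq_card_imp_inj_on[OF finite_residue_reps])
  have pos1: "n1 > 0" unfolding n1 by linarith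
  have "(\<lambda>(b, c). (b * n2 + c * n3) mod n1) ` residue_reps = {..<n1}"
  proof (intro equalityI subsetI)
    fix k assume k: "k \<in> {..<n1}"
    obtain a b c d where wt: "wt a b c d mod n1 = k mod n1" using ex_wt_mod by blast
    then obtain a b c d where wt: "wt a b c d mod n1 = k mod n1" and std: "std a b c d"
      using ex_std by metis
    have "int (wt a b c d) mod int n1 = int ((b + d * (p + 1)) * n2 + c * n3) mod int n1"
      unfolding wt_eq_residue_rep by (simp only: mod_mult_self3)
    then have "((b + d * (p + 1)) * n2 + c * n3) mod n1 = k mod n1"
      unfolding wt[symmetric] by (metis of_nat_eq_iff of_nat_mod)
    then show "k \<in> (\<lambda>(b, c). (b * n2 + c * n3) mod n1) ` residue_reps"
      using k by (intro image_eqI[OF _ std_residue_rep[OF std]]) simp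
  qed (use pos1 in auto)
  then show "card ((\<lambda>(b, c). (b * n2 + c * n3) mod n1) ` residue_reps) = card residue_reps"
    by (simp add: card_residue_reps)
qed

lemma std_unique:
  assumes s: "std a b c d" "std a' b' c' d'" and eq: "wt a b c d = wt a' b' c' d'"
  shows "a = a' \<and> b = b' \<and> c = c' \<and> d = d'"
proof -
  let ?b = "b + d * (p + 1)" and ?b' = "b' + d' * (p + 1)"
  let ?e = "int a - int d * int r" and ?e' = "int a' - int d' * int r"
  have pos1: "n1 > 0" unfolding n1 by linarith
  have e: "?e * int n1 + int (?b * n2 + c * n3) = ?e' * int n1 + int (?b' * n2 + c' * n3)"
    using eq wt_eq_residue_rep by metis
  then have "int (?b * n2 + c * n3) mod int n1 = int (?b' * n2 + c' * n3) mod int n1"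
    by (metis mod_mult_self3)
  then have "(?b * n2 + c * n3) mod n1 = (?b' * n2 + c' * n3) mod n1"
    by (metis of_nat_eq_iff of_nat_mod)
  with inj_on_residue_reps std_residue_rep[OF s(1)] std_residue_rep[OF s(2)] have bc: "?b = ?b'" "c = c'"
    unfolding inj_on_def by fastforce+
  then have ee: "?e = ?e'" using e pos1 by simp
  \<comment> \<open>The exponent \<open>?e\<close> determines \<open>d\<close>: it is nonnegative
    for \<open>d = 0\<close>, and by \<open>a < r\<close> it lies in \<open>[-r, 0)\<close> for
    \<open>d = 1\<close> and in \<open>[-2r, -r)\<close> for \<open>d = 2\<close>. These ranges are
    disjoint.\<close>
  have d: "- (int d * int r) \<le> ?e" "0 < d \<Longrightarrow> ?e < int r - int d * int r"
    and d': "- (int d' * int r) \<le> ?e'" "0 < d' \<Longrightarrow> ?e' < int r - int d' * int r"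
    and le2: "d \<le> 2" "d' \<le> 2"
    using s unfolding std_def by auto
  have "d = d'"
  proof -
    have "d = 0 \<or> d = 1 \<or> d = 2" "d' = 0 \<or> d' = 1 \<or> d' = 2" using le2 by auto
    then show ?thesis using d d' ee by auto
  qed
  then show ?thesis using bc ee by auto
qed

section \<open>Order as the degree of the standard factorization\<close>

lemma in_order_at_least_iff:
  "s \<in> order_at_least [n1, n2, n3, n4] n \<longleftrightarrow> (\<exists>a b c d. s = wt a b c d \<and> n \<le> a + b + c + d)"
proof -
  have w: "weight [n1, n2, n3, n4] [a, b, c, d] = wt a b c d" for a b c d
    by (simp add: weight_def wt_def numeral_eq_Suc)
  have "(\<exists>es. s = weight [n1, n2, n3, n4] es \<and> length es = length [n1, n2, n3, n4] \<and> n \<le> sum_list es) \<longleftrightarrow>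
     (\<exists>a b c d. s = weight [n1, n2, n3, n4] [a, b, c, d] \<and> n \<le> sum_list [a, b, c, d])"
    by (auto simp: length_Suc_conv) (metis length_Cons list.size(3))
  then show ?thesis unfolding order_at_least_def w by (auto simp: add.assoc)
qed

lemma order_eq_std:
  "order_at_least [n1, n2, n3, n4] n - order_at_least [n1, n2, n3, n4] (Suc n) =
     (\<lambda>(a, b, c, d). wt a b c d) ` {(a, b, c, d). std a b c d \<and> a + b + c + d = n}"
  (is "?L = ?f ` ?T")
proof (intro equalityI subsetI)
  fix s assume "s \<in> ?L"
  then have 1: "\<exists>a b c d. s = wt a b c d \<and> n \<le> a + b + c + d"
    and 2: "\<And>a b c d. s = wt a b c d \<Longrightarrow> a + b + c + d \<le> n"
    by (auto simp: in_order_at_least_iff not_less_eq_eq)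
  from 1 obtain a b c d where s: "s = wt a b c d" "n \<le> a + b + c + d" by blast
  with ex_std obtain a' b' c' d' where "std a' b' c' d'" "s = wt a' b' c' d'" "n \<le> a' + b' + c' + d'"
    by (metis le_trans)
  with 2[of a' b' c' d'] show "s \<in> ?f ` ?T"
    by (intro image_eqI[of _ _ "(a', b', c', d')"]) auto
next
  fix s assume "s \<in> ?f ` ?T"
  then obtain a b c d where s: "s = wt a b c d" "std a b c d" "a + b + c + d = n" by auto
  \<comment> \<open>Any factorization is at most as long as some standard one of the same weight,
    and uniqueness identifies the latter with the given one.\<close>
  have "a' + b' + c' + d' \<le> n" if "s = wt a' b' c' d'" for a' b' c' d'
    using ex_std[of a' b' c' d'] that s std_unique by metis
  then show "s \<in> ?L" using s by (auto simp: in_order_at_least_iff not_less_eq_eq)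
qed

section \<open>Injection of standard monomials into the next degree\<close>

lemma card_std_mono:
  "card {(a, b, c, d). std a b c d \<and> a + b + c + d = n}
     \<le> card {(a, b, c, d). std a b c d \<and> a + b + c + d = Suc n}" (is "card (?T n) \<le> _")
proof (rule card_inj_on_le)
  \<comment> \<open>The last two branches apply when \<open>a = r - 1\<close>. They remove
    \<open>r\<close> factors, namely \<open>x\<^sub>1 ^ (r - 1)\<close> and one
    \<open>x\<^sub>4\<close>, and insert \<open>r + 1\<close> factors \<open>x\<^sub>2\<close>, so
    the degree rises by one. The weight plays no part here, only the count matters.\<close>
  define g where "g = (\<lambda>(a, b, c, d). if d = 0 \<or> a + 1 < r then (a + 1, b, c, d)
    else if d = 1 then (0, b + 1 + r, c, 0) else (0, r + 1, 0 :: nat, 1 :: nat))"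
  show "inj_on g (?T n)"
  proof (rule inj_onI)
    fix x y assume xy: "x \<in> ?T n" "y \<in> ?T n" and eq: "g x = g y"
    obtain a b c d a' b' c' d' where [simp]: "x = (a, b, c, d)" "y = (a', b', c', d')"
      by (metis surj_pair)
    have "std a b c d" "std a' b' c' d'" using xy by simp_all
    \<comment> \<open>This suffices to separate the branches: the first gives a positive exponent of
      \<open>x\<^sub>1\<close>, the other two give \<open>0\<close> and differ in the exponent of
      \<open>x\<^sub>4\<close>. In these two, \<open>a < r\<close> forces \<open>a = r - 1\<close>,
      so nothing is lost.\<close>
    then have "d = 0 \<or> a < r \<and> d = 1 \<or> a < r \<and> d = 2 \<and> b = 0 \<and> c = 0"
      "d' = 0 \<or> a' < r \<and> d' = 1 \<or> a' < r \<and> d' = 2 \<and> b' = 0 \<and> c' = 0"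
      by (auto simp: std_def)
    then show "x = y"
    proof (elim disjE conjE)
    qed (use eq in \<open>simp_all add: g_def split: if_splits\<close>)
  qed
  show "g ` ?T n \<subseteq> ?T (Suc n)"
  proof (rule image_subsetI)
    fix x assume x: "x \<in> ?T n"
    obtain a b c d where [simp]: "x = (a, b, c, d)" by (metis surj_pair)
    from x have s: "std a b c d" and deg: "a + b + c + d = n" by simp_all
    from s consider "d = 0 \<or> a + 1 < r" | "a + 1 = r" "d = 1" "c \<le> q" "b \<le> p + 1" | "a + 1 = r" "d = 2" "b = 0" "c = 0"
      unfolding std_def by linarith
    then show "g x \<in> ?T (Suc n)"
    proof cases
      case 1
      then have "std (a + 1) b c d" using s unfolding std_def by linarith
      then show ?thesis using 1 deg by (auto simp: g_def)
    next
      case 2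
      \<comment> \<open>By \<open>b \<le> p + 1\<close> and \<open>r < p\<close> the new exponent of
        \<open>x\<^sub>2\<close> is at most \<open>2 * p + 1\<close>.\<close>
      then have "std 0 (b + 1 + r) c 0" using r_less_p unfolding std_def by linarith
      then show ?thesis using 2 deg by (auto simp: g_def)
    next
      case 3
      then have "std 0 (r + 1) 0 1" using r_less_p pos unfolding std_def by linarith
      then show ?thesis using 3 deg by (auto simp: g_def)
    qed
  qed
  have "?T (Suc n) \<subseteq> {..Suc n} \<times> {..Suc n} \<times> {..Suc n} \<times> {..Suc n}" by auto
  then show "finite (?T (Suc n))" by (rule finite_subset) simp
qed

theorem card_order_mono:
  "card (order_at_least [n1, n2, n3, n4] n - order_at_least [n1, n2, n3, n4] (Suc n))
     \<le> card (order_at_least [n1, n2, n3, n4] (Suc n) - order_at_least [n1, n2, n3, n4] (Suc (Suc n)))"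
proof -
  have "inj_on (\<lambda>(a, b, c, d). wt a b c d) {(a, b, c, d). std a b c d \<and> a + b + c + d = n}" for n
  proof (rule inj_onI)
    fix x y
    assume xy: "x \<in> {(a, b, c, d). std a b c d \<and> a + b + c + d = n}"
      "y \<in> {(a, b, c, d). std a b c d \<and> a + b + c + d = n}"
      and eq: "(\<lambda>(a, b, c, d). wt a b c d) x = (\<lambda>(a, b, c, d). wt a b c d) y"
    obtain a b c d a' b' c' d' where [simp]: "x = (a, b, c, d)" "y = (a', b', c', d')"
      by (metis surj_pair)
    have "std a b c d" "std a' b' c' d'" "wt a b c d = wt a' b' c' d'" using xy eq by simp_all
    from std_unique[OF this] show "x = y" by simp
  qed
  then show ?thesis using card_std_mono unfolding order_eq_std by (simp add: card_image)
qed

end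

section \<open>Return to the parameters of the semigroup\<close>

theorem theorem4p3:
  fixes n\<^sub>1 n\<^sub>2 n\<^sub>3 n\<^sub>4 :: nat
    and \<alpha>\<^sub>1 \<alpha>\<^sub>2 \<alpha>\<^sub>3 \<alpha>\<^sub>4 \<alpha>\<^sub>2\<^sub>1 :: int
    and l :: nat
    and R :: "'k::alg_closed_field fps ring"
    and \<mm> :: "'k fps set"
  assumes "minimally_generates [n\<^sub>1, n\<^sub>2, n\<^sub>3, n\<^sub>4]"
    and "pseudo_symmetric (generated_semigroup [n\<^sub>1, n\<^sub>2, n\<^sub>3, n\<^sub>4])"
    and "has_parameters n\<^sub>1 n\<^sub>2 n\<^sub>3 n\<^sub>4 \<alpha>\<^sub>1 \<alpha>\<^sub>2 \<alpha>\<^sub>3 \<alpha>\<^sub>4 \<alpha>\<^sub>2\<^sub>1"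
    and "\<alpha>\<^sub>4 = 3"
    and "n\<^sub>1 < n\<^sub>2" and "n\<^sub>2 < n\<^sub>3" and "n\<^sub>3 < n\<^sub>4"
    and "\<alpha>\<^sub>2 > \<alpha>\<^sub>2\<^sub>1 + 1"
    and "int l * \<alpha>\<^sub>1 + (2 * int l + 3) * \<alpha>\<^sub>2\<^sub>1 + \<alpha>\<^sub>3 > (2 * int l + 2) * \<alpha>\<^sub>2 + (int l + 1)"
    and "\<And>k. k < l \<Longrightarrow>
           \<not> int k * \<alpha>\<^sub>1 + (2 * int k + 3) * \<alpha>\<^sub>2\<^sub>1 + \<alpha>\<^sub>3 > (2 * int k + 2) * \<alpha>\<^sub>2 + (int k + 1)"
    and "l = 0"
    and "R = semigroup_ring [n\<^sub>1, n\<^sub>2, n\<^sub>3, n\<^sub>4]"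
    and "\<mm> = semigroup_ring_max_ideal [n\<^sub>1, n\<^sub>2, n\<^sub>3, n\<^sub>4]"
  shows "\<forall>n. hilbert_function R \<mm> n \<le> hilbert_function R \<mm> (n + 1)"
proof
  fix n
  note par = assms(3)[unfolded has_parameters_def]
  \<comment> \<open>The bounds on the parameters make these differences nonnegative, so
    \<open>nat\<close> loses nothing; \<open>0 < u\<close> is the condition
    \<open>\<alpha>\<^sub>2\<^sub>1 < \<alpha>\<^sub>1 - 1\<close>.\<close>
  define p q r u where "p = nat (\<alpha>\<^sub>2 - 1)" and "q = nat (\<alpha>\<^sub>3 - 1)" and "r = nat \<alpha>\<^sub>2\<^sub>1"
    and "u = nat (\<alpha>\<^sub>1 - \<alpha>\<^sub>2\<^sub>1 - 1)"
  then have \<alpha>: "\<alpha>\<^sub>2 = int p + 1" "\<alpha>\<^sub>3 = int q + 1" "\<alpha>\<^sub>2\<^sub>1 = int r" "\<alpha>\<^sub>1 = int r + int u + 1"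
    and pos: "0 < r" "0 < u" "0 < q"
    using par by auto
  have eqs: "int n\<^sub>1 = int (2 * (p + 1) * (q + 1) + 1)"
    "int n\<^sub>2 = int (3 * r * (q + 1) + u * q + q + 1)"
    "int n\<^sub>3 = int (3 * r + 3 * u + 2 * u * p + 1)"
    "int n\<^sub>4 = int ((r + u + 1) * (p + 1) * q + r * p + p + 1)"
    using par unfolding \<alpha> assms(4) by (simp_all add: algebra_simps)
  interpret alpha4_eq_3 n\<^sub>1 n\<^sub>2 n\<^sub>3 n\<^sub>4 p q r u
  proof
    show "Gcd {n\<^sub>1, n\<^sub>2, n\<^sub>3, n\<^sub>4} = 1" using assms(1) by (simp add: minimally_generates_def)
    show "r < p" using assms(8) unfolding \<alpha> by linarith
    show "2 * p + 2 < 3 * r + q" using assms(9) unfolding \<alpha> assms(11) by simp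
  qed (use eqs[unfolded of_nat_eq_iff] pos assms(5-7) in simp_all)
  have "0 < n\<^sub>1" by (simp add: n1)
  then have "0 \<notin> set [n\<^sub>1, n\<^sub>2, n\<^sub>3, n\<^sub>4]" using assms(5-7) by auto
  then show "hilbert_function R \<mm> n \<le> hilbert_function R \<mm> (n + 1)"
    using card_order_mono[of n] by (simp add: assms(12,13) hilbert_function_eq)
qed


end
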